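(* Consider a double round-robin tournament with four teams, under the rules given in the context, after Matchday 4 (i.e. each team has played four matches). "Runner-up" and "third-placed team" refer to the teams ranked second and third after Matchday 4. (i) If the tie-breaking rule is goal difference, then a team is guaranteed to win the tournament after Matchday 4 if and only if it has at least seven points more than the runner-up. (ii) If the tie-breaking rule is head-to-head records, then a team is guaranteed to win the tournament after Matchday 4 if and only if either it has at least seven points more than the runner-up, or all of the following conditions hold: - it leads by six points over the runner-up; and - it leads by at least seven points over the third-placed team; and - it has played two matches against the runner-up.
   Context: Double round-robin tournament with four teams: each team plays each of the other three teams exactly twice (once at home, once away). The tournament consists of six rounds (Matchdays 1 to 6); in each round two matches are played so that every team plays exactly one match. The two matches of a round are played simultaneously, so after a given round exactly the results of the matches of that round and all previous rounds are known. Schedule assumption: a team can play its second match against another team only after it has played once against all other teams (so Matchdays 1-3 form a single round-robin, and so do Matchdays 4-6). Match results: the result of a match is a pair of non-negative integers (goals scored by the two teams), without an upper bound. A win is worth 3 points, a draw 1 point, a loss 0 points. Ranking: teams are ranked by total number of points. Ties in points are broken either by goal difference (total goals scored minus total goals conceded in all group matches, higher is better), or by head-to-head results/records (higher number of points obtained in the matches played among the tied teams, followed by superior goal difference in the matches played among the tied teams). The final ranking is the one after all six rounds; the winner is the team ranked first in it. A team is guaranteed to win the tournament after Matchday 4 if it is ranked first in the final ranking for all possible results of the matches still to be played (Matchdays 5 and 6). *)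

theory Defs
  imports Main
begin

text \<open>
  The teams are the elements of a finite type. A match is a pair (home team, away team) of
  different teams, so that any two teams meet twice.
\<close>

definition matches :: "('a \<times> 'a) set" where
  "matches = {(h, a). h \<noteq> a}"

text \<open>
  A schedule assigns a matchday to every match. The last clause of \<open>valid_schedule\<close> is the schedule
  assumption: the second match of \<open>t\<close> against \<open>u\<close> is played after the first match of \<open>t\<close> against
  every opponent \<open>v\<close>.
\<close>

type_synonym 'a schedule = "'a \<times> 'a \<Rightarrow> nat"

definition valid_schedule :: "'a schedule \<Rightarrow> bool" where
  "valid_schedule md \<longleftrightarrow>
     (\<forall>m\<in>matches. md m \<in> {1..6}) \<and>
     (\<forall>d\<in>{1..6}. \<forall>t. \<exists>!m. m \<in> matches \<and> md m = d \<and> (fst m = t \<or> snd m = t)) \<and>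
     (\<forall>t u v. u \<noteq> t \<and> v \<noteq> t \<longrightarrow> min (md (t, v)) (md (v, t)) < max (md (t, u)) (md (u, t)))"

text \<open>
  The known results: a played match is mapped to (goals of the home team, goals of the away team),
  a match not yet played to \<open>None\<close>.
\<close>

type_synonym 'a results = "'a \<times> 'a \<rightharpoonup> nat \<times> nat"

definition results_after :: "'a schedule \<Rightarrow> nat \<Rightarrow> 'a results \<Rightarrow> bool" where
  "results_after md k X \<longleftrightarrow> dom X = {m \<in> matches. md m \<le> k}"

definition match_points :: "nat \<Rightarrow> nat \<Rightarrow> nat" where
  "match_points scored conceded =
     (if scored > conceded then 3 else if scored = conceded then 1 else 0)"

text \<open>Points and goal difference of \<open>t\<close> in its matches played against teams in \<open>S\<close>.\<close>

definition points_among :: "'a set \<Rightarrow> 'a results \<Rightarrow> 'a \<Rightarrow> nat" where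
  "points_among S X t = (\<Sum>u\<in>S - {t}.
     (case X (t, u) of None \<Rightarrow> 0 | Some (g, g') \<Rightarrow> match_points g g') +
     (case X (u, t) of None \<Rightarrow> 0 | Some (g, g') \<Rightarrow> match_points g' g))"

definition goal_diff_among :: "'a set \<Rightarrow> 'a results \<Rightarrow> 'a \<Rightarrow> int" where
  "goal_diff_among S X t = (\<Sum>u\<in>S - {t}.
     (case X (t, u) of None \<Rightarrow> 0 | Some (g, g') \<Rightarrow> int g - int g') +
     (case X (u, t) of None \<Rightarrow> 0 | Some (g, g') \<Rightarrow> int g' - int g))"

abbreviation points :: "'a results \<Rightarrow> 'a \<Rightarrow> nat" where
  "points \<equiv> points_among UNIV"

definition tied_teams :: "'a results \<Rightarrow> 'a \<Rightarrow> 'a set" where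
  "tied_teams X t = {u. points X u = points X t}"

definition better_goal_diff :: "'a results \<Rightarrow> 'a \<Rightarrow> 'a \<Rightarrow> bool" where
  "better_goal_diff X t u \<longleftrightarrow>
     points X t > points X u \<or>
     points X t = points X u \<and> goal_diff_among UNIV X t > goal_diff_among UNIV X u"

definition better_head_to_head :: "'a results \<Rightarrow> 'a \<Rightarrow> 'a \<Rightarrow> bool" where
  "better_head_to_head X t u \<longleftrightarrow>
     points X t > points X u \<or>
     points X t = points X u \<and>
       (let T = tied_teams X t in
          points_among T X t > points_among T X u \<or>
          points_among T X t = points_among T X u \<and>
            goal_diff_among T X t > goal_diff_among T X u)"

text \<open>
  A ranking rule lists all teams, best first, for any known results, in a way compatible with the
  criteria \<open>better\<close>. Teams that the criteria do not separate may be listed in any order, so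
  statements about all ranking rules cover every further tie-breaker.
\<close>

type_synonym 'a ranking_rule = "'a results \<Rightarrow> 'a list"

definition follows :: "('a results \<Rightarrow> 'a \<Rightarrow> 'a \<Rightarrow> bool) \<Rightarrow> 'a ranking_rule \<Rightarrow> bool" where
  "follows better R \<longleftrightarrow>
     (\<forall>X. distinct (R X) \<and> set (R X) = UNIV \<and> sorted_wrt (\<lambda>t u. \<not> better X u t) (R X))"

text \<open>
  \<open>ranked R X i\<close> is the team in position \<open>i\<close>, counted from 1.
\<close>

definition ranked :: "'a ranking_rule \<Rightarrow> 'a results \<Rightarrow> nat \<Rightarrow> 'a" where
  "ranked R X i = R X ! (i - 1)"

definition guaranteed_to_win :: "'a schedule \<Rightarrow> 'a ranking_rule \<Rightarrow> 'a results \<Rightarrow> 'a \<Rightarrow> bool" where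
  "guaranteed_to_win md R X t \<longleftrightarrow>
     (\<forall>Y. results_after md 6 Y \<and> X \<subseteq>\<^sub>m Y \<longrightarrow> ranked R Y 1 = t)"

definition matches_played :: "'a results \<Rightarrow> 'a \<Rightarrow> 'a \<Rightarrow> nat" where
  "matches_played X t u = card (dom X \<inter> {(t, u), (u, t)})"

end

theory Submission
  imports Defs
begin

text \<open>
  After Matchday 4 every team has two matches left, against two different opponents; its third
  opponent it has already met twice. The worst case for \<open>t\<close> with respect to a rival \<open>u\<close> is that \<open>t\<close>
  loses and \<open>u\<close> wins all remaining matches by a huge margin while the remaining matches without
  \<open>t\<close> and \<open>u\<close> are goalless draws. Then \<open>u\<close> catches up by six points. Under goal difference, \<open>u\<close>
  overtakes \<open>t\<close> if the lead was at most six points. Under head-to-head records, the draws ensure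
  that no third team is tied with \<open>t\<close> and \<open>u\<close>, so \<open>u\<close> also overtakes \<open>t\<close> at a lead of exactly six
  points if one of their two matches is still open. If both have been played, such a lead over \<open>u\<close>
  and a larger one over the other teams force \<open>t\<close> to have collected more points in them than \<open>u\<close>.
\<close>

section \<open>Points and goal difference of one team against a single opponent\<close>

definition pair_points :: "'a results \<Rightarrow> 'a \<Rightarrow> 'a \<Rightarrow> nat" where
  "pair_points X t u =
     (case X (t, u) of None \<Rightarrow> 0 | Some (g, g') \<Rightarrow> match_points g g') +
     (case X (u, t) of None \<Rightarrow> 0 | Some (g, g') \<Rightarrow> match_points g' g)"

definition pair_goal_diff :: "'a results \<Rightarrow> 'a \<Rightarrow> 'a \<Rightarrow> int" where
  "pair_goal_diff X t u =
     (case X (t, u) of None \<Rightarrow> 0 | Some (g, g') \<Rightarrow> int g - int g') +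
     (case X (u, t) of None \<Rightarrow> 0 | Some (g, g') \<Rightarrow> int g' - int g)"

definition unplayed :: "'a results \<Rightarrow> 'a \<Rightarrow> 'a \<Rightarrow> nat" where
  "unplayed X t u = card ({(t, u), (u, t)} - dom X)"

lemma points_among_eq: "points_among S X t = (\<Sum>u\<in>S - {t}. pair_points X t u)"
  by (simp add: points_among_def pair_points_def)

lemma goal_diff_among_eq: "goal_diff_among S X t = (\<Sum>u\<in>S - {t}. pair_goal_diff X t u)"
  by (simp add: goal_diff_among_def pair_goal_diff_def)

lemma unplayed_commute: "unplayed X t u = unplayed X u t"
  by (simp add: unplayed_def insert_commute)

lemma unplayed_eq:
  assumes "t \<noteq> u"
  shows "unplayed X t u = (if X (t, u) = None then 1 else 0) + (if X (u, t) = None then 1 else 0)"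
  using assms by (auto simp: unplayed_def insert_Diff_if domIff)

lemma matches_played_eq_2_iff:
  assumes "t \<noteq> u"
  shows "matches_played X t u = 2 \<longleftrightarrow> unplayed X t u = 0"
  using assms by (auto simp: unplayed_eq matches_played_def Int_insert_right domIff)

lemma match_points_le: "match_points g h \<le> 3"
  by (simp add: match_points_def)

lemma pair_points_one_played:
  assumes "t \<noteq> u" "unplayed X t u = 1"
  shows "(pair_points X t u, pair_points X u t) \<in> {(3, 0), (1, 1), (0, 3)}"
  using assms
  by (auto simp: unplayed_eq pair_points_def match_points_def split: option.splits if_splits)

lemma pair_points_both_played:
  assumes "t \<noteq> u" "unplayed X t u = 0"
  shows "(pair_points X t u, pair_points X u t) \<in> {(6, 0), (4, 1), (3, 3), (2, 2), (1, 4), (0, 6)}"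
  using assms
  by (auto simp: unplayed_eq pair_points_def match_points_def split: option.splits if_splits)

lemma map_le_cases:
  assumes "X \<subseteq>\<^sub>m Y"
  shows "X m = None \<or> X m = Y m"
  using assms by (metis domIff map_le_def)

lemma pair_points_mono:
  assumes "X \<subseteq>\<^sub>m Y"
  shows "pair_points X t u \<le> pair_points Y t u"
  using map_le_cases[OF assms, of "(t, u)"] map_le_cases[OF assms, of "(u, t)"]
  by (auto simp: pair_points_def)

lemma pair_points_le:
  assumes "X \<subseteq>\<^sub>m Y" "t \<noteq> u"
  shows "pair_points Y t u \<le> pair_points X t u + 3 * unplayed X t u"
proof -
  have win: "(case z of None \<Rightarrow> 0 | Some (g, g') \<Rightarrow> match_points g g') \<le> 3"
    "(case z of None \<Rightarrow> 0 | Some (g, g') \<Rightarrow> match_points g' g) \<le> 3" for z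
    by (auto split: option.split simp: match_points_le)
  show ?thesis
    using map_le_cases[OF assms(1), of "(t, u)"] map_le_cases[OF assms(1), of "(u, t)"]
      win(1)[of "Y (t, u)"] win(2)[of "Y (u, t)"] assms(2)
    by (auto simp: pair_points_def unplayed_eq)
qed

text \<open>Once both matches between two teams are over, their head-to-head record is
  final.\<close>

lemma pair_points_both_played_extend:
  assumes "X \<subseteq>\<^sub>m Y" "t \<noteq> u" "unplayed X t u = 0"
  shows "pair_points Y t u = pair_points X t u"
  using pair_points_mono[OF assms(1), of t u] pair_points_le[OF assms(1,2)] assms(3) by simp

section \<open>Filling in the open matches\<close>

text \<open>In \<open>complete X G\<close>, \<open>G t u\<close> is the number of goals \<open>t\<close> scores in each open match against \<open>u\<close>.\<close>

definition complete :: "'a results \<Rightarrow> ('a \<Rightarrow> 'a \<Rightarrow> nat) \<Rightarrow> 'a results" where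
  "complete X G m =
     (if m \<in> matches - dom X then Some (G (fst m) (snd m), G (snd m) (fst m)) else X m)"

lemma map_le_complete: "X \<subseteq>\<^sub>m complete X G"
  by (simp add: map_le_def complete_def)

text \<open>\<open>G\<close> ignores the venue, so every open match between \<open>t\<close> and
  \<open>u\<close> contributes the same number of points.\<close>

lemma pair_points_complete:
  assumes "t \<noteq> u"
  shows "pair_points (complete X G) t u =
    pair_points X t u + unplayed X t u * match_points (G t u) (G u t)"
  using assms by (auto simp: pair_points_def complete_def unplayed_eq matches_def domIff)

lemma pair_goal_diff_complete:
  assumes "t \<noteq> u"
  shows "pair_goal_diff (complete X G) t u =
    pair_goal_diff X t u + int (unplayed X t u) * (int (G t u) - int (G u t))"
  using assms by (auto simp: pair_goal_diff_def complete_def unplayed_eq matches_def domIff)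

lemma results_after_complete:
  assumes "valid_schedule md" "results_after md k X"
  shows "results_after md 6 (complete X G)"
proof -
  have "{m \<in> matches. md m \<le> 6} = matches"
    using assms(1) by (auto simp: valid_schedule_def)
  moreover have "dom (complete X G) = matches"
    using assms(2) by (auto simp: results_after_def complete_def dom_def)
  ultimately show ?thesis
    by (simp add: results_after_def)
qed

text \<open>For \<open>u\<close> different from \<open>t\<close> the disjunction produces the whole
  worst case: \<open>u\<close> wins N-0 against everyone, \<open>t\<close> loses 0-N against
  everyone, and a match without \<open>u\<close> and \<open>t\<close> ends 0-0.\<close>

definition rout :: "'a \<Rightarrow> 'a \<Rightarrow> nat \<Rightarrow> 'a \<Rightarrow> 'a \<Rightarrow> nat" where
  "rout u t N x y = (if x = u \<or> y = t then N else 0)"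

section \<open>Matches and points still open after Matchday 4\<close>

context
  fixes md :: "'a::finite schedule" and X :: "'a results"
  assumes four: "card (UNIV :: 'a set) = 4"
    and valid: "valid_schedule md"
    and day4: "results_after md 4 X"
begin

lemma matchday_unique:
  assumes "(x, y) \<in> matches" "(x', y') \<in> matches" "md (x, y) = md (x', y')"
    and "t \<in> {x, y}" "t \<in> {x', y'}"
  shows "(x, y) = (x', y')"
proof -
  have "md (x, y) \<in> {1..6}"
    using valid assms(1) by (simp add: valid_schedule_def)
  hence "\<exists>!m. m \<in> matches \<and> md m = md (x, y) \<and> (fst m = t \<or> snd m = t)"
    using valid by (simp add: valid_schedule_def)
  moreover have "fst (x, y) = t \<or> snd (x, y) = t" "fst (x', y') = t \<or> snd (x', y') = t"
    using assms(4,5) by auto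
  ultimately show ?thesis
    using assms(1-3) by metis
qed

lemma in_dom_iff: "m \<in> dom X \<longleftrightarrow> m \<in> matches \<and> md m \<le> 4"
  using day4 by (simp add: results_after_def)

text \<open>
  If both matches between \<open>t\<close> and \<open>u\<close> were still to come, the second match of \<open>t\<close> against each of
  the three opponents would be on Matchday 6.
\<close>

lemma unplayed_le_1:
  assumes "t \<noteq> u"
  shows "unplayed X t u \<le> 1"
proof (rule ccontr)
  assume "\<not> ?thesis"
  hence "(t, u) \<notin> dom X" "(u, t) \<notin> dom X"
    using assms by (auto simp: unplayed_eq domIff split: if_splits)
  hence late: "md (t, u) \<ge> 5" "md (u, t) \<ge> 5"
    using assms by (auto simp: in_dom_iff matches_def)
  have last: "md (t, v) = 6 \<or> md (v, t) = 6" if "v \<noteq> t" for v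
  proof -
    have "min (md (t, u)) (md (u, t)) < max (md (t, v)) (md (v, t))"
      using valid assms that by (simp add: valid_schedule_def)
    moreover have "md (t, v) \<le> 6" "md (v, t) \<le> 6"
      using valid that by (auto simp: valid_schedule_def matches_def)
    ultimately show ?thesis
      using late by linarith
  qed
  have "UNIV \<noteq> {t, u}"
    using four assms by (metis card_2_iff numeral_eq_iff semiring_norm(85,87,88))
  then obtain v where v: "v \<noteq> t" "v \<noteq> u"
    by blast
  have "\<exists>m\<in>{(t, u), (u, t)}. md m = 6" "\<exists>m\<in>{(t, v), (v, t)}. md m = 6"
    using last[of u] last[of v] v assms by auto
  then obtain m m' where m: "m \<in> {(t, u), (u, t)}" "m' \<in> {(t, v), (v, t)}" "md m = md m'"
    by metis
  hence "m = m'"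
    using v assms matchday_unique[of "fst m" "snd m" "fst m'" "snd m'" t] by (auto simp: matches_def)
  thus False
    using m v assms by auto
qed

text \<open>The open matches of \<open>t\<close> are those on Matchdays 5 and 6, and there is
  exactly one on each. Grouping them by opponent turns the cardinality into the sum.\<close>

lemma sum_unplayed: "(\<Sum>u\<in>UNIV - {t}. unplayed X t u) = 2"
proof -
  have ex: "\<exists>!m. m \<in> matches \<and> md m = d \<and> (fst m = t \<or> snd m = t)" if "d \<in> {1..6}" for d
    using valid that by (simp add: valid_schedule_def)
  have day5: "\<exists>!m. m \<in> matches \<and> md m = 5 \<and> (fst m = t \<or> snd m = t)"
    and day6: "\<exists>!m. m \<in> matches \<and> md m = 6 \<and> (fst m = t \<or> snd m = t)"
    by (intro ex, simp)+
  obtain m5 where m5: "m5 \<in> matches" "md m5 = 5" "fst m5 = t \<or> snd m5 = t"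
    and u5: "\<And>m. m \<in> matches \<Longrightarrow> md m = 5 \<Longrightarrow> fst m = t \<or> snd m = t \<Longrightarrow> m = m5"
    using day5 by (elim ex1E) blast
  obtain m6 where m6: "m6 \<in> matches" "md m6 = 6" "fst m6 = t \<or> snd m6 = t"
    and u6: "\<And>m. m \<in> matches \<Longrightarrow> md m = 6 \<Longrightarrow> fst m = t \<or> snd m = t \<Longrightarrow> m = m6"
    using day6 by (elim ex1E) blast
  let ?M = "\<lambda>u. {(t, u), (u, t)} - dom X"
  have union: "(\<Union>u\<in>UNIV - {t}. ?M u) = {m \<in> matches - dom X. fst m = t \<or> snd m = t}"
    by (auto simp: matches_def)
  have "(\<Sum>u\<in>UNIV - {t}. unplayed X t u) = card (\<Union>u\<in>UNIV - {t}. ?M u)"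
    unfolding unplayed_def by (rule card_UN_disjoint[symmetric]) auto
  also have "(\<Union>u\<in>UNIV - {t}. ?M u) = {m5, m6}"
  proof (unfold union, intro equalityI subsetI)
    fix m assume "m \<in> {m \<in> matches - dom X. fst m = t \<or> snd m = t}"
    hence m: "m \<in> matches" "fst m = t \<or> snd m = t" "\<not> md m \<le> 4"
      by (auto simp: in_dom_iff)
    moreover have "md m \<le> 6"
      using valid m(1) by (auto simp: valid_schedule_def)
    ultimately have "md m = 5 \<or> md m = 6"
      by linarith
    thus "m \<in> {m5, m6}"
      using m u5 u6 by blast
  next
    fix m assume "m \<in> {m5, m6}"
    thus "m \<in> {m \<in> matches - dom X. fst m = t \<or> snd m = t}"
      using m5 m6 by (auto simp: in_dom_iff)
  qed
  also have "card {m5, m6} = 2"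
    using m5 m6 by (auto simp: card_insert_if)
  finally show ?thesis .
qed

text \<open>There are two open matches in total, at most one per opponent and none against
  \<open>p\<close>, so each of the other two opponents accounts for one.\<close>

lemma one_opponent_met_twice:
  assumes "p \<noteq> t" "unplayed X t p = 0" "u \<notin> {t, p}"
  shows "unplayed X t u = 1"
proof -
  let ?S = "UNIV - {t} - {p} - {u}"
  have "(\<Sum>v\<in>UNIV - {t}. unplayed X t v) =
      unplayed X t p + (unplayed X t u + (\<Sum>v\<in>?S. unplayed X t v))"
    using assms by (simp add: sum.remove[of "UNIV - {t}" p] sum.remove[of "UNIV - {t} - {p}" u])
  moreover have "(\<Sum>v\<in>?S. unplayed X t v) \<le> of_nat (card ?S) * 1"
    using unplayed_le_1[of t] by (intro sum_bounded_above) auto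
  \<comment> \<open>Of four teams just one is left, and it takes at most one of the two open
    matches.\<close>
  moreover have "card ?S = 1"
    using assms four by (simp add: card_Diff_singleton_if)
  ultimately show ?thesis
    using assms(2,3) sum_unplayed[of t] unplayed_le_1[of t u] by auto
qed

lemma points_le:
  assumes "X \<subseteq>\<^sub>m Y"
  shows "points Y x \<le> points X x + 6"
proof -
  have "points Y x \<le> (\<Sum>y\<in>UNIV - {x}. pair_points X x y + 3 * unplayed X x y)"
    unfolding points_among_eq using assms by (auto intro!: sum_mono pair_points_le)
  also have "\<dots> = points X x + 3 * (\<Sum>y\<in>UNIV - {x}. unplayed X x y)"
    by (simp add: points_among_eq sum.distrib sum_distrib_left)
  finally show ?thesis
    by (simp add: sum_unplayed)
qed

lemma points_mono:
  assumes "X \<subseteq>\<^sub>m Y"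
  shows "points X x \<le> points Y x"
  unfolding points_among_eq using assms by (auto intro!: sum_mono pair_points_mono)

lemma points_complete:
  "points (complete X G) x =
     points X x + (\<Sum>y\<in>UNIV - {x}. unplayed X x y * match_points (G x y) (G y x))"
  by (simp add: points_among_eq pair_points_complete flip: sum.distrib)

lemma goal_diff_complete:
  "goal_diff_among UNIV (complete X G) x = goal_diff_among UNIV X x +
     (\<Sum>y\<in>UNIV - {x}. int (unplayed X x y) * (int (G x y) - int (G y x)))"
  by (simp add: goal_diff_among_eq pair_goal_diff_complete flip: sum.distrib)

section \<open>The worst case: \<open>u\<close> wins everything, \<open>t\<close> loses
  everything\<close>

context
  fixes u t :: 'a and N :: nat
  assumes ut: "u \<noteq> t" and N: "N > 0"
begin

lemma points_rout_winner: "points (complete X (rout u t N)) u = points X u + 6"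
proof -
  have "(\<Sum>y\<in>UNIV - {u}. unplayed X u y * match_points (rout u t N u y) (rout u t N y u)) =
      (\<Sum>y\<in>UNIV - {u}. unplayed X u y * 3)"
    using ut N by (intro sum.cong) (auto simp: rout_def match_points_def)
  also have "\<dots> = 6"
    by (simp add: sum_unplayed flip: sum_distrib_right)
  finally show ?thesis
    by (simp add: points_complete)
qed

lemma points_rout_loser: "points (complete X (rout u t N)) t = points X t"
  using ut N by (auto simp: points_complete rout_def match_points_def)

text \<open>A third team gets at most one point from each of its two open matches, except for two
  extra points if it meets \<open>t\<close>, which happens at most once. Staying below six keeps it
  out of a tie later.\<close>

lemma points_rout_other:
  assumes "x \<noteq> u" "x \<noteq> t"
  shows "points (complete X (rout u t N)) x \<le> points X x + 4"
proof -
  have "(\<Sum>y\<in>UNIV - {x}. unplayed X x y * match_points (rout u t N x y) (rout u t N y x)) \<le>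
      (\<Sum>y\<in>UNIV - {x}. unplayed X x y + (if y = t then 2 * unplayed X x t else 0))"
    using ut N assms by (intro sum_mono) (auto simp: rout_def match_points_def)
  also have "\<dots> = 2 + 2 * unplayed X x t"
    using assms by (simp add: sum.distrib sum_unplayed)
  also have "\<dots> \<le> 4"
    using unplayed_le_1[OF assms(2)] by simp
  finally show ?thesis
    by (simp add: points_complete)
qed

lemma goal_diff_rout_winner:
  "goal_diff_among UNIV (complete X (rout u t N)) u = goal_diff_among UNIV X u + 2 * int N"
proof -
  have "(\<Sum>y\<in>UNIV - {u}. int (unplayed X u y) * (int (rout u t N u y) - int (rout u t N y u))) =
      (\<Sum>y\<in>UNIV - {u}. int (unplayed X u y) * int N)"
    using ut by (intro sum.cong) (auto simp: rout_def)
  also have "\<dots> = 2 * int N"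
    by (simp add: sum_unplayed flip: sum_distrib_right of_nat_sum)
  finally show ?thesis
    by (simp add: goal_diff_complete)
qed

lemma goal_diff_rout_loser:
  "goal_diff_among UNIV (complete X (rout u t N)) t = goal_diff_among UNIV X t - 2 * int N"
proof -
  have "(\<Sum>y\<in>UNIV - {t}. int (unplayed X t y) * (int (rout u t N t y) - int (rout u t N y t))) =
      (\<Sum>y\<in>UNIV - {t}. int (unplayed X t y) * (- int N))"
    using ut by (intro sum.cong) (auto simp: rout_def)
  also have "\<dots> = - 2 * int N"
    by (simp add: sum_unplayed sum_negf flip: sum_distrib_right of_nat_sum)
  finally show ?thesis
    by (simp add: goal_diff_complete)
qed

end

section \<open>How a rival overtakes the leader\<close>

lemma overtaken_by_goal_diff:
  assumes "u \<noteq> t" "points X t \<le> points X u + 6"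
  shows "\<exists>Y. results_after md 6 Y \<and> X \<subseteq>\<^sub>m Y \<and> better_goal_diff Y u t"
proof -
  \<comment> \<open>Each team has two open matches, so the goal differences of \<open>u\<close> and
    \<open>t\<close> move apart by four times \<open>N\<close>. This \<open>N\<close> exceeds the
    sum of their present absolute values.\<close>
  define N where
    "N = Suc (nat \<bar>goal_diff_among UNIV X t\<bar> + nat \<bar>goal_diff_among UNIV X u\<bar>)"
  have "4 * int N > goal_diff_among UNIV X t - goal_diff_among UNIV X u"
    unfolding N_def by simp
  moreover have "N > 0"
    by (simp add: N_def)
  ultimately have "better_goal_diff (complete X (rout u t N)) u t"
    using assms(2) points_rout_winner[OF assms(1), of N] points_rout_loser[OF assms(1), of N]
      goal_diff_rout_winner[OF assms(1), of N] goal_diff_rout_loser[OF assms(1), of N]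
    by (auto simp: better_goal_diff_def)
  thus ?thesis
    using results_after_complete[OF valid day4] map_le_complete by blast
qed

lemma overtaken_on_points:
  assumes "u \<noteq> t" "points X t < points X u + 6"
  shows "\<exists>Y. results_after md 6 Y \<and> X \<subseteq>\<^sub>m Y \<and> points Y u > points Y t"
proof (intro exI conjI)
  \<comment> \<open>Only points matter here, so victories by one goal suffice.\<close>
  show "points (complete X (rout u t 1)) u > points (complete X (rout u t 1)) t"
    using assms by (simp add: points_rout_winner points_rout_loser)
qed (rule results_after_complete[OF valid day4] map_le_complete)+

text \<open>From its single match against \<open>u\<close>, \<open>t\<close> has at most three
  points, and \<open>u\<close> earns three in the open one. So \<open>u\<close> is at least level on
  head-to-head points, and \<open>N\<close> settles the goal difference if they are equal.\<close>

lemma overtaken_by_head_to_head: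
  assumes "u \<noteq> t" "points X t = points X u + 6" "unplayed X t u = 1"
    and "\<And>x. x \<noteq> t \<Longrightarrow> points X x + 6 \<le> points X t"
  shows "\<exists>Y. results_after md 6 Y \<and> X \<subseteq>\<^sub>m Y \<and> better_head_to_head Y u t"
proof -
  define N where "N = Suc (nat \<bar>pair_goal_diff X t u\<bar> + nat \<bar>pair_goal_diff X u t\<bar>)"
  define Y where "Y = complete X (rout u t N)"
  have "N > 0"
    by (simp add: N_def)
  note Y = points_rout_winner[OF assms(1) this, folded Y_def]
    points_rout_loser[OF assms(1) \<open>N > 0\<close>, folded Y_def]
    points_rout_other[OF assms(1) \<open>N > 0\<close>, folded Y_def]
  have tied: "points Y u = points Y t"
    using Y(1,2) assms(2) by simp
  \<comment> \<open>Other teams trail \<open>t\<close> by at least six points and gain at most four,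
    so the tie involves only \<open>t\<close> and \<open>u\<close>.\<close>
  have "points Y x \<noteq> points Y t" if "x \<notin> {t, u}" for x
    using Y(2) Y(3)[of x] assms(4)[of x] that by auto
  hence T: "tied_teams Y u = {t, u}"
    using tied by (auto simp: tied_teams_def)
  have u: "unplayed X u t = 1"
    using assms(3) by (simp add: unplayed_commute)
  have among: "points_among {t, u} Y u = pair_points Y u t"
    "points_among {t, u} Y t = pair_points Y t u"
    "goal_diff_among {t, u} Y u = pair_goal_diff Y u t"
    "goal_diff_among {t, u} Y t = pair_goal_diff Y t u"
    using assms(1) by (auto simp: points_among_eq goal_diff_among_eq insert_Diff_if)
  have "pair_points Y u t = pair_points X u t + 3" "pair_points Y t u = pair_points X t u"
    "pair_goal_diff Y u t = pair_goal_diff X u t + int N"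
    "pair_goal_diff Y t u = pair_goal_diff X t u - int N"
    using assms(1,3) u \<open>N > 0\<close>
    by (auto simp: Y_def pair_points_complete pair_goal_diff_complete rout_def match_points_def)
  moreover have "pair_points X t u \<le> 3"
    using pair_points_one_played[of t u X] assms(1,3) by auto
  ultimately have "better_head_to_head Y u t"
    using tied by (auto simp: better_head_to_head_def T among Let_def N_def)
  moreover have "results_after md 6 Y" "X \<subseteq>\<^sub>m Y"
    unfolding Y_def by (rule results_after_complete[OF valid day4] map_le_complete)+
  ultimately show ?thesis
    by metis
qed

section \<open>A lead of six points over an opponent already met twice\<close>

text \<open>
  Without an advantage in the matches against \<open>p\<close>, \<open>t\<close> could lead by six points only if it had won
  its other two matches and \<open>p\<close> had lost its other two. But then the teams that beat \<open>p\<close> would have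
  as many points as \<open>p\<close>, which cannot have more than three.
\<close>

lemma head_to_head_advantage:
  assumes "p \<noteq> t" "unplayed X t p = 0" "points X t = points X p + 6"
    and "\<And>u. u \<notin> {t, p} \<Longrightarrow> points X u + 7 \<le> points X t"
  shows "pair_points X p t < pair_points X t p"
proof -
  have "card (UNIV - {t, p}) = 2"
    using four assms(1) by (simp add: card_Diff_subset)
  then obtain q r where qr: "UNIV - {t, p} = {q, r}" "q \<noteq> r"
    by (auto simp: card_2_iff)
  have ne: "q \<noteq> t" "q \<noteq> p" "r \<noteq> t" "r \<noteq> p"
    using qr by blast+
  have "UNIV = {t, p, q, r}"
    using qr(1) by blast
  hence opp: "UNIV - {t} = {p, q, r}" "UNIV - {p} = {t, q, r}" "UNIV - {q} = {t, p, r}"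
    using ne qr(2) assms(1) by auto
  have pt: "unplayed X p t = 0"
    using assms(2) by (simp add: unplayed_commute)
  have one: "unplayed X t q = 1" "unplayed X t r = 1" "unplayed X p q = 1" "unplayed X p r = 1"
    using one_opponent_met_twice[OF assms(1,2)] one_opponent_met_twice[OF assms(1)[symmetric] pt] ne
    by auto
  \<comment> \<open>For \<open>q\<close> the match against \<open>p\<close> is enough: if
    \<open>p\<close> lost it, \<open>q\<close> has at least three points, so a lead of seven over
    \<open>q\<close> gives \<open>t\<close> at least ten and \<open>p\<close> at least four.\<close>
  have "points X t = pair_points X t p + pair_points X t q + pair_points X t r"
    "points X p = pair_points X p t + pair_points X p q + pair_points X p r"
    "points X q \<ge> pair_points X q p"
    unfolding points_among_eq opp using ne qr(2) assms(1) by auto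
  moreover have "points X q + 7 \<le> points X t"
    using assms(4) ne by auto
  moreover note assms(3) pair_points_both_played[OF assms(1)[symmetric] assms(2)]
    pair_points_one_played[OF ne(1)[symmetric] one(1)]
    pair_points_one_played[OF ne(3)[symmetric] one(2)]
    pair_points_one_played[OF ne(2)[symmetric] one(3)]
    pair_points_one_played[OF ne(4)[symmetric] one(4)]
  ultimately show ?thesis
    by auto
qed

text \<open>At best \<open>p\<close> draws level with \<open>t\<close>, while all other teams stay
  strictly behind. A tie is therefore decided by the two matches between \<open>t\<close> and
  \<open>p\<close>, whose results are already known.\<close>

lemma better_head_to_head_if_advantage:
  assumes "X \<subseteq>\<^sub>m Y" "p \<noteq> t" "unplayed X t p = 0" "points X t = points X p + 6"
    and "\<And>u. u \<notin> {t, p} \<Longrightarrow> points X u + 7 \<le> points X t"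
  shows "better_head_to_head Y t p"
proof (cases "points Y p < points Y t")
  case False
  hence tied: "points Y t = points Y p"
    using points_le[OF assms(1), of p] points_mono[OF assms(1), of t] assms(4) by linarith
  have "points Y u < points Y t" if "u \<notin> {t, p}" for u
    using points_le[OF assms(1), of u] points_mono[OF assms(1), of t] assms(5)[OF that] by linarith
  hence T: "tied_teams Y t = {t, p}"
    using tied by (fastforce simp: tied_teams_def)
  have "points_among {t, p} Y t = pair_points X t p" "points_among {t, p} Y p = pair_points X p t"
    using assms(2,3) pair_points_both_played_extend[OF assms(1), of t p]
      pair_points_both_played_extend[OF assms(1), of p t]
    by (auto simp: points_among_eq insert_Diff_if unplayed_commute)
  thus ?thesis
    using head_to_head_advantage[OF assms(2-5)] tied by (simp add: better_head_to_head_def T)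
qed (simp add: better_head_to_head_def)

section \<open>Ranking lists for criteria that compare points first\<close>

context
  fixes better :: "'a results \<Rightarrow> 'a \<Rightarrow> 'a \<Rightarrow> bool" and R :: "'a ranking_rule"
  assumes follows: "follows better R"
    and points_first: "\<And>X t u. points X u < points X t \<Longrightarrow> better X t u"
begin

text \<open>A ranking only forbids listing a team below one that it beats under
  \<open>better\<close>. By \<open>points_first\<close> this already makes the points weakly
  decreasing along the list.\<close>

lemma ranking_cases:
  obtains a b c d where "R Z = [a, b, c, d]" "distinct [a, b, c, d]" "UNIV = {a, b, c, d}"
    "points Z b \<le> points Z a" "points Z c \<le> points Z b" "points Z d \<le> points Z c"
    "\<And>u. u \<noteq> a \<Longrightarrow> \<not> better Z u a"
proof -
  have R: "distinct (R Z)" "set (R Z) = UNIV" "sorted_wrt (\<lambda>t u. \<not> better Z u t) (R Z)"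
    using follows by (auto simp: follows_def)
  hence "length (R Z) = 4"
    using four by (metis distinct_card)
  then obtain a b c d where eq: "R Z = [a, b, c, d]"
    by (auto simp: numeral_eq_Suc length_Suc_conv)
  have "points Z y \<le> points Z x" if "\<not> better Z y x" for x y
    using points_first[of Z x y] that by (meson not_le)
  hence "points Z b \<le> points Z a" "points Z c \<le> points Z b" "points Z d \<le> points Z c"
    using R(3) eq by auto
  moreover have univ: "UNIV = {a, b, c, d}"
    using R(2) eq by auto
  moreover have "\<not> better Z u a" if "u \<noteq> a" for u
  proof -
    have "u \<in> {b, c, d}"
      using that univ by blast
    thus ?thesis
      using R(3) eq by auto
  qed
  ultimately show ?thesis
    using that[OF eq] R(1) eq by metis
qed

lemma ranked_first:
  assumes "\<And>u. u \<noteq> t \<Longrightarrow> better Z t u"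
  shows "ranked R Z 1 = t"
proof -
  obtain a b c d where R: "R Z = [a, b, c, d]" and first: "\<And>u. u \<noteq> a \<Longrightarrow> \<not> better Z u a"
    using ranking_cases[of Z] by metis
  have "a = t"
    using assms[of a] first[of t] by metis
  thus ?thesis
    by (simp add: R ranked_def)
qed

lemma not_ranked_first:
  assumes "u \<noteq> t" "better Z u t"
  shows "ranked R Z 1 \<noteq> t"
proof -
  obtain a b c d where "R Z = [a, b, c, d]" "\<And>u. u \<noteq> a \<Longrightarrow> \<not> better Z u a"
    using ranking_cases[of Z] by metis
  thus ?thesis
    using assms by (auto simp: ranked_def)
qed

text \<open>A positive lead over the second team forces \<open>t\<close> to be first, and the second
  team is then the strongest rival on points.\<close>

lemma lead_over_runner_up:
  assumes "k > 0"
  shows "points X (ranked R X 2) + k \<le> points X t \<longleftrightarrow> (\<forall>u. u \<noteq> t \<longrightarrow> points X u + k \<le> points X t)"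
proof -
  obtain a b c d where R: "R X = [a, b, c, d]" and dist: "distinct [a, b, c, d]"
    and univ: "UNIV = {a, b, c, d}"
    and le: "points X b \<le> points X a" "points X c \<le> points X b" "points X d \<le> points X c"
    using ranking_cases[of X] by metis
  have t: "t \<in> {a, b, c, d}"
    using univ by blast
  have b: "ranked R X 2 = b"
    by (simp add: R ranked_def)
  show ?thesis unfolding b
  proof
    assume lead: "points X b + k \<le> points X t"
    hence "t = a"
      using t le assms by auto
    show "\<forall>u. u \<noteq> t \<longrightarrow> points X u + k \<le> points X t"
    proof (intro allI impI)
      fix u assume "u \<noteq> t"
      hence "u \<in> {b, c, d}"
        using univ \<open>t = a\<close> by blast
      thus "points X u + k \<le> points X t"
        using lead le by auto
    qed
  next
    assume lead: "\<forall>u. u \<noteq> t \<longrightarrow> points X u + k \<le> points X t"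
    show "points X b + k \<le> points X t"
    proof (cases "b = t")
      \<comment> \<open>The hypothesis says nothing about \<open>b\<close> when \<open>b\<close> is
        \<open>t\<close>. The bound comes from \<open>a\<close>, which has at least as many points
        as \<open>b\<close>.\<close>
      case True
      hence "points X a + k \<le> points X t"
        using lead dist by auto
      thus ?thesis
        using le(1) by simp
    qed (use lead in auto)
  qed
qed

text \<open>This replaces ranking positions by teams: \<open>p\<close> must be the runner-up, being
  the only team less than seven points behind \<open>t\<close>.\<close>

lemma lead_with_close_runner_up:
  "(points X t = points X (ranked R X 2) + 6 \<and> points X t \<ge> points X (ranked R X 3) + 7 \<and>
      matches_played X t (ranked R X 2) = 2) \<longleftrightarrow>
   (\<exists>p. p \<noteq> t \<and> unplayed X t p = 0 \<and> points X t = points X p + 6 \<and>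
      (\<forall>u. u \<notin> {t, p} \<longrightarrow> points X u + 7 \<le> points X t))"
  (is "?L \<longleftrightarrow> ?R")
proof -
  obtain a b c d where R: "R X = [a, b, c, d]" and dist: "distinct [a, b, c, d]"
    and univ: "UNIV = {a, b, c, d}"
    and le: "points X b \<le> points X a" "points X c \<le> points X b" "points X d \<le> points X c"
    using ranking_cases[of X] by metis
  have ranked: "ranked R X 2 = b" "ranked R X 3 = c"
    by (auto simp: R ranked_def)
  have t: "t \<in> {a, b, c, d}"
    using univ by blast
  show ?thesis unfolding ranked
  proof
    assume lead: "points X t = points X b + 6 \<and> points X t \<ge> points X c + 7 \<and>
      matches_played X t b = 2"
    hence "t = a"
      using t le by auto
    have "points X u + 7 \<le> points X t" if "u \<notin> {t, b}" for u
    proof -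
      have "u \<in> {c, d}"
        using that univ \<open>t = a\<close> by blast
      thus ?thesis
        using lead le by auto
    qed
    moreover have "b \<noteq> t"
      using dist \<open>t = a\<close> by auto
    ultimately show ?R
      using lead matches_played_eq_2_iff[of t b X] by (intro exI[of _ b]) simp
  next
    assume ?R
    then obtain p where p: "p \<noteq> t" "unplayed X t p = 0" "points X t = points X p + 6"
      and lead: "\<And>u. u \<notin> {t, p} \<Longrightarrow> points X u + 7 \<le> points X t"
      by blast
    have less: "points X u < points X t" if "u \<noteq> t" for u
      using lead[of u] p(3) that by (cases "u = p") auto
    have "t = a"
      using less[of a] less[of b] less[of c] t le by fastforce
    have "p = b"
    proof (rule ccontr)
      assume "p \<noteq> b"
      hence "points X b < points X p"
        using lead[of b] p(3) dist \<open>t = a\<close> by auto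
      moreover have "p \<in> {c, d}"
        using univ p(1) \<open>p \<noteq> b\<close> \<open>t = a\<close> by blast
      ultimately show False
        using le by auto
    qed
    thus "points X t = points X b + 6 \<and> points X t \<ge> points X c + 7 \<and> matches_played X t b = 2"
      using p lead[of c] dist \<open>t = a\<close> matches_played_eq_2_iff[of t b X] by auto
  qed
qed

lemma guaranteed_to_win_if_seven_ahead:
  assumes "\<And>u. u \<noteq> t \<Longrightarrow> points X u + 7 \<le> points X t"
  shows "guaranteed_to_win md R X t"
  unfolding guaranteed_to_win_def
proof (intro allI impI)
  fix Y assume "results_after md 6 Y \<and> X \<subseteq>\<^sub>m Y"
  hence XY: "X \<subseteq>\<^sub>m Y"
    by blast
  show "ranked R Y 1 = t"
  proof (intro ranked_first points_first)
    fix u assume "u \<noteq> t"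
    thus "points Y u < points Y t"
      using assms[of u] points_le[OF XY, of u] points_mono[OF XY, of t] by linarith
  qed
qed

lemma not_guaranteed_to_win:
  assumes "\<exists>Y. results_after md 6 Y \<and> X \<subseteq>\<^sub>m Y \<and> better Y u t" "u \<noteq> t"
  shows "\<not> guaranteed_to_win md R X t"
proof -
  obtain Y where "results_after md 6 Y" "X \<subseteq>\<^sub>m Y" "better Y u t"
    using assms(1) by (elim exE conjE)
  hence "ranked R Y 1 \<noteq> t"
    using not_ranked_first[OF assms(2)] by simp
  thus ?thesis
    using \<open>results_after md 6 Y\<close> \<open>X \<subseteq>\<^sub>m Y\<close> by (auto simp: guaranteed_to_win_def)
qed

end

section \<open>The two characterizations\<close>

lemma guaranteed_goal_diff:
  assumes "follows better_goal_diff R"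
  shows "guaranteed_to_win md R X t \<longleftrightarrow> points X (ranked R X 2) + 7 \<le> points X t"
proof -
  have first: "better_goal_diff Z x y" if "points Z y < points Z x" for Z and x y :: 'a
    using that by (simp add: better_goal_diff_def)
  have "points X u + 7 \<le> points X t" if "guaranteed_to_win md R X t" "u \<noteq> t" for u
    using overtaken_by_goal_diff[OF that(2)] not_guaranteed_to_win[OF assms first] that
    by fastforce
  hence "guaranteed_to_win md R X t \<longleftrightarrow> (\<forall>u. u \<noteq> t \<longrightarrow> points X u + 7 \<le> points X t)"
    using guaranteed_to_win_if_seven_ahead[OF assms first] by blast
  thus ?thesis
    using lead_over_runner_up[OF assms first, of 7] by simp
qed

lemma guaranteed_head_to_head:
  assumes "follows better_head_to_head R"
  shows "guaranteed_to_win md R X t \<longleftrightarrow>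
    points X t \<ge> points X (ranked R X 2) + 7 \<or>
    (points X t = points X (ranked R X 2) + 6 \<and>
     points X t \<ge> points X (ranked R X 3) + 7 \<and>
     matches_played X t (ranked R X 2) = 2)"
    (is "_ \<longleftrightarrow> ?seven \<or> ?six")
proof -
  have first: "better_head_to_head Z x y" if "points Z y < points Z x" for Z and x y :: 'a
    using that by (simp add: better_head_to_head_def)
  have seven: "?seven \<longleftrightarrow> (\<forall>u. u \<noteq> t \<longrightarrow> points X u + 7 \<le> points X t)"
    using lead_over_runner_up[OF assms first, of 7] by simp
  have six: "?six \<longleftrightarrow> (\<exists>p. p \<noteq> t \<and> unplayed X t p = 0 \<and> points X t = points X p + 6 \<and>
      (\<forall>u. u \<notin> {t, p} \<longrightarrow> points X u + 7 \<le> points X t))"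
    using lead_with_close_runner_up[OF assms first] by simp
  show ?thesis
  proof (intro iffI)
    assume guar: "guaranteed_to_win md R X t"
    have lead6: "points X u + 6 \<le> points X t" if "u \<noteq> t" for u
    proof (rule ccontr)
      assume "\<not> ?thesis"
      thus False
        using overtaken_on_points[OF that] first not_guaranteed_to_win[OF assms first _ that] guar
        by (meson not_le)
    qed
    \<comment> \<open>A lead of exactly six over a team with a match against \<open>t\<close> still
      open is lost on head-to-head records; \<open>lead6\<close> rules out ties with further
      teams.\<close>
    have lead7: "points X u + 7 \<le> points X t" if "u \<noteq> t" "unplayed X t u = 1" for u
    proof (rule ccontr)
      assume "\<not> ?thesis"
      hence "points X t = points X u + 6"
        using lead6[OF that(1)] by simp
      thus False
        using overtaken_by_head_to_head[OF that(1) _ that(2) lead6] guar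
          not_guaranteed_to_win[OF assms first _ that(1)] by blast
    qed
    show "?seven \<or> ?six"
    proof (cases ?seven)
      case False
      \<comment> \<open>By \<open>lead7\<close> the team \<open>p\<close> has been met twice. Both
        other opponents then still have a match against \<open>t\<close>, so \<open>lead7\<close>
        applies to them.\<close>
      then obtain p where p: "p \<noteq> t" "\<not> points X p + 7 \<le> points X t"
        using seven by blast
      hence "unplayed X t p = 0" "points X t = points X p + 6"
        using lead7[of p] lead6[of p] unplayed_le_1[of t p] by fastforce+
      thus ?thesis
        using p(1) lead7 one_opponent_met_twice[of p t] unfolding six by blast
    qed blast
  next
    assume "?seven \<or> ?six"
    thus "guaranteed_to_win md R X t"
    proof
      assume ?seven
      thus ?thesis
        using guaranteed_to_win_if_seven_ahead[OF assms first] seven by blast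
    next
      assume ?six
      then obtain p where p: "p \<noteq> t" "unplayed X t p = 0" "points X t = points X p + 6"
        and lead: "\<And>u. u \<notin> {t, p} \<Longrightarrow> points X u + 7 \<le> points X t"
        unfolding six by blast
      show ?thesis unfolding guaranteed_to_win_def
      proof (intro allI impI)
        fix Y assume "results_after md 6 Y \<and> X \<subseteq>\<^sub>m Y"
        hence XY: "X \<subseteq>\<^sub>m Y"
          by blast
        have ahead: "better_head_to_head Y t u" if "u \<noteq> t" for u
        proof (cases "u = p")
          case True
          thus ?thesis
            using better_head_to_head_if_advantage[OF XY p lead] by simp
        next
          case False
          hence "points Y u < points Y t"
            using lead[of u] points_le[OF XY, of u] points_mono[OF XY, of t] that by simp
          thus ?thesis
            by (rule first)
        qed
        show "ranked R Y 1 = t"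
          by (rule ranked_first[OF assms first]) (simp_all add: ahead)
      qed
    qed
  qed
qed

end

theorem proposition3p2:
  fixes md :: "'a::finite schedule" and X :: "'a results" and R :: "'a ranking_rule" and t :: 'a
  assumes "card (UNIV :: 'a set) = 4"
    and "valid_schedule md"
    and "results_after md 4 X"
  shows "(follows better_goal_diff R \<longrightarrow>
            (guaranteed_to_win md R X t \<longleftrightarrow> points X t \<ge> points X (ranked R X 2) + 7)) \<and>
         (follows better_head_to_head R \<longrightarrow>
            (guaranteed_to_win md R X t \<longleftrightarrow>
               points X t \<ge> points X (ranked R X 2) + 7 \<or>
               (points X t = points X (ranked R X 2) + 6 \<and>
                points X t \<ge> points X (ranked R X 3) + 7 \<and>
                matches_played X t (ranked R X 2) = 2)))"
  using guaranteed_goal_diff[OF assms] guaranteed_head_to_head[OF assms] by blast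

end
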